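(* Let $\delta\in[0,1/2)\cup(1/2,1]$, $J\in\mathbb{R}$, and consider the dynamical system on $\mathbb{R}^3$ (coordinates indexed by $i\in\{A,B,C\}$) $$\dot{x}_i=(1-x_i)\,e^{2[-\delta Jx_{a(i)}-(1-\delta)Jx_{h(i)}+J/2]}-x_i\,e^{-2[-\delta Jx_{a(i)}-(1-\delta)Jx_{h(i)}+J/2]},\qquad i\in\{A,B,C\}.$$ The point $(1/2,1/2,1/2)^T$ is a fixed point for all $J$, and: (a) for $J<0$, there is a bifurcation at $J_c=-1$: the fixed point $(1/2,1/2,1/2)^T$ loses stability and two stable fixed points appear for $J<J_c$; (b) for $J>0$, there is a Hopf (Andronov–Hopf) bifurcation at $J_c=2$.
   Context: The three indices $A,B,C$ are arranged cyclically; $h(i)$ denotes the neighbour of $i$ in the clockwise direction and $a(i)$ the neighbour in the anticlockwise direction (e.g. $h(A)=B,h(B)=C,h(C)=A$, and $a=h^{-1}$). $J$ is the bifurcation parameter. *)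

theory Defs
  imports "HOL-Analysis.Analysis" "HOL-Computational_Algebra.Polynomial"
begin

text \<open>The three cyclically arranged indices A, B, C.\<close>
datatype abc = A | B | C

lemma UNIV_abc: "(UNIV :: abc set) = {A, B, C}"
  using abc.exhaust by auto

instance abc :: finite
  by standard (simp add: UNIV_abc)

text \<open>Clockwise neighbour h and anticlockwise neighbour a.\<close>
fun nb_h :: "abc \<Rightarrow> abc" where
  "nb_h A = B" | "nb_h B = C" | "nb_h C = A"

fun nb_a :: "abc \<Rightarrow> abc" where
  "nb_a A = C" | "nb_a B = A" | "nb_a C = B"

text \<open>The vector field with parameters delta and J.\<close>
definition vf :: "real \<Rightarrow> real \<Rightarrow> real^abc \<Rightarrow> real^abc" where
  "vf \<delta> J x = (\<chi> i.
     (let g = - \<delta> * J * x$(nb_a i) - (1 - \<delta>) * J * x$(nb_h i) + J / 2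
      in (1 - x$i) * exp (2 * g) - x$i * exp (- 2 * g)))"

definition ctr :: "real^abc" where
  "ctr = (\<chi> i. 1/2)"

text \<open>Jacobian matrix of a vector field at a point (matrix of the Frechet derivative).\<close>
definition jac :: "(real^'n \<Rightarrow> real^'n) \<Rightarrow> real^'n \<Rightarrow> real^'n^'n" where
  "jac F p = matrix (frechet_derivative F (at p))"

definition cplx :: "real^'n^'n \<Rightarrow> complex^'n^'n" where
  "cplx M = (\<chi> i j. complex_of_real (M$i$j))"

text \<open>Characteristic polynomial and (complex) eigenvalues of a real square matrix.\<close>
definition charpoly :: "real^'n^'n \<Rightarrow> complex poly" where
  "charpoly M = det (mat [:0, 1:] - (\<chi> i j. [: cplx M $ i $ j :]))"

definition eigs :: "real^'n^'n \<Rightarrow> complex set" where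
  "eigs M = {z. det (mat z - cplx M) = 0}"

text \<open>Linear (asymptotic) stability / instability of an equilibrium.\<close>
definition lin_stable :: "(real^'n \<Rightarrow> real^'n) \<Rightarrow> real^'n \<Rightarrow> bool" where
  "lin_stable F p \<longleftrightarrow> F p = 0 \<and> F differentiable (at p) \<and>
     (\<forall>z\<in>eigs (jac F p). Re z < 0)"

definition lin_unstable :: "(real^'n \<Rightarrow> real^'n) \<Rightarrow> real^'n \<Rightarrow> bool" where
  "lin_unstable F p \<longleftrightarrow> F p = 0 \<and> F differentiable (at p) \<and>
     (\<exists>z\<in>eigs (jac F p). Re z > 0)"

text \<open>Andronov-Hopf bifurcation of the equilibrium p of the family F at parameter Jc
  (Kuznetsov): p is an equilibrium for parameters near Jc; at Jc the Jacobian has a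
  simple pair of eigenvalues \<plusminus>i\<omega> with \<omega> > 0 and no other eigenvalues on the
  imaginary axis; the eigenvalue branch through i\<omega> crosses the imaginary axis
  transversally.\<close>
definition hopf_bifurcation :: "(real \<Rightarrow> real^'n \<Rightarrow> real^'n) \<Rightarrow> real^'n \<Rightarrow> real \<Rightarrow> bool" where
  "hopf_bifurcation F p Jc \<longleftrightarrow>
     (\<forall>\<^sub>F J in nhds Jc. F J p = 0 \<and> F J differentiable (at p)) \<and>
     (\<exists>\<omega>>0. \<exists>lam :: real \<Rightarrow> complex. \<exists>d.
        lam Jc = \<i> * complex_of_real \<omega> \<and>
        (\<forall>\<^sub>F J in nhds Jc. lam J \<in> eigs (jac (F J) p)) \<and>
        (lam has_vector_derivative d) (at Jc) \<and> Re d \<noteq> 0 \<and>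
        order (\<i> * complex_of_real \<omega>) (charpoly (jac (F Jc) p)) = 1 \<and>
        order (- \<i> * complex_of_real \<omega>) (charpoly (jac (F Jc) p)) = 1 \<and>
        (\<forall>\<mu>\<in>eigs (jac (F Jc) p). Re \<mu> = 0 \<longrightarrow>
            \<mu> = \<i> * complex_of_real \<omega> \<or> \<mu> = - \<i> * complex_of_real \<omega>))"

end

theory Submission
  imports Defs
begin

(* At a symmetric point vec x the Jacobian of the field is circulant, with diagonal d and
   off-diagonal entries r, q; its eigenvalues are d + q + r (along the diagonal direction) and
   the pair d - (q + r)/2 \<plusminus> i sqrt 3 (q - r)/2.  At the centre they are -2 - 2J and
   J - 2 \<plusminus> i sqrt 3 (2\<delta> - 1) J: the real one changes sign at J = -1, the pair crosses the
   imaginary axis at J = 2 with unit speed.  For J < -1 the further symmetric equilibria are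
   (1 \<plusminus> y)/2 with artanh y = -J y; the bound artanh y < y/(1 - y^2) makes them stable, and
   artanh y \<ge> y + y^3/3 gives y^2 \<le> 3(-J - 1), so they merge into the centre as J tends
   to -1. *)

lemma order_linear_factor: "order x [:- a, 1:] = (if x = a then 1 else 0)"
  using order_power_n_n[of a 1] by (auto intro: order_0I)

lemma order_distinct_linear_factors:
  fixes a b c :: "'a::idom"
  assumes "distinct [a, b, c]" and "x \<in> {a, b, c}"
  shows "order x ([:- a, 1:] * [:- b, 1:] * [:- c, 1:]) = 1"
  using assms
  by (auto simp del: mult_pCons_left mult_pCons_right simp add: order_mult order_linear_factor)

lemma det_abc:
  "det (M::'a::comm_ring_1^abc^abc) =
    M$A$A * M$B$B * M$C$C + M$A$B * M$B$C * M$C$A + M$A$C * M$B$A * M$C$B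
  - M$A$A * M$B$C * M$C$B - M$A$B * M$B$A * M$C$C - M$A$C * M$B$B * M$C$A"
proof -
  have f1: "finite {B, C}" "A \<notin> {B, C}" by auto
  have f2: "finite {C}" "B \<notin> {C}" by auto
  show ?thesis
    unfolding det_def UNIV_abc
    unfolding sum_over_permutations_insert[OF f1]
    unfolding sum_over_permutations_insert[OF f2]
    unfolding permutes_sing
    by (simp add: sign_swap_id permutation_swap_id sign_compose sign_id swap_id_eq algebra_simps)
qed

lemma poly_charpoly_abc: "poly (charpoly M) z = det (mat z - cplx (M :: real^abc^abc))"
  unfolding charpoly_def det_abc poly_add poly_mult poly_diff by (simp add: mat_def)

lemma eigs_eq_linear_factors:
  assumes "charpoly (M :: real^abc^abc) = [:- a, 1:] * [:- b, 1:] * [:- c, 1:]"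
  shows "eigs M = {a, b, c}"
proof -
  have linear: "poly [:- u, 1:] z = z - u" for u z :: complex by simp
  show ?thesis
    unfolding eigs_def poly_charpoly_abc[symmetric] assms poly_mult linear mult_eq_0_iff right_minus_eq
    by auto
qed

definition circulant :: "real \<Rightarrow> real \<Rightarrow> real \<Rightarrow> real^abc^abc" where
  "circulant d r q = (\<chi> i j. if j = i then d else if j = nb_a i then r else q)"

definition circulant_eig :: "real \<Rightarrow> real \<Rightarrow> real \<Rightarrow> complex" where
  "circulant_eig d r q = Complex (d - (q + r) / 2) (sqrt 3 * (q - r) / 2)"

lemma charpoly_circulant:
  "charpoly (circulant d r q) =
     [:- of_real (d + q + r), 1:] * [:- circulant_eig d r q, 1:] * [:- cnj (circulant_eig d r q), 1:]"
proof (rule poly_ext)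
  fix z
  let ?u = "circulant_eig d r q"
  have "(z - ?u) * (z - cnj ?u) = (z - of_real (Re ?u))\<^sup>2 + of_real ((Im ?u)\<^sup>2)"
    by (simp add: complex_eq_iff power2_eq_square algebra_simps)
  also have "\<dots> = (z - d + (q + r) / 2)\<^sup>2 + 3 * (q - r)\<^sup>2 / 4"
    by (simp add: circulant_eig_def power_mult_distrib power_divide)
      (simp add: algebra_simps)
  finally have "(z - ?u) * (z - cnj ?u) = (z - d + (q + r) / 2)\<^sup>2 + 3 * (q - r)\<^sup>2 / 4" .
  moreover have "poly (charpoly (circulant d r q)) z =
        (z - of_real (d + q + r)) * ((z - d + (q + r) / 2)\<^sup>2 + 3 * (q - r)\<^sup>2 / 4)"
    by (simp add: poly_charpoly_abc det_abc circulant_def cplx_def mat_def field_simps power2_eq_square)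
  moreover have "poly ([:- of_real (d + q + r), 1:] * [:- ?u, 1:] * [:- cnj ?u, 1:]) z =
      (z - of_real (d + q + r)) * ((z - ?u) * (z - cnj ?u))"
    by (simp add: algebra_simps)
  ultimately show "poly (charpoly (circulant d r q)) z =
     poly ([:- of_real (d + q + r), 1:] * [:- ?u, 1:] * [:- cnj ?u, 1:]) z"
    by simp
qed

lemma eigs_circulant:
  "eigs (circulant d r q) = {of_real (d + q + r), circulant_eig d r q, cnj (circulant_eig d r q)}"
  using charpoly_circulant by (rule eigs_eq_linear_factors)

lemma Re_eigs_circulant_neg:
  assumes "d + q + r < 0" and "d - (q + r) / 2 < 0" and "z \<in> eigs (circulant d r q)"
  shows "Re z < 0"
  using assms by (auto simp: eigs_circulant circulant_eig_def)

lemma has_derivative_vec_componentwise: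
  fixes f :: "real^'m \<Rightarrow> real^'n"
  assumes "\<And>i. ((\<lambda>x. f x $ i) has_derivative (\<lambda>h. f' h $ i)) (at a)"
  shows "(f has_derivative f') (at a)"
proof (rule iffD2[OF has_derivative_componentwise_within], intro ballI)
  fix b :: "real^'n" assume "b \<in> Basis"
  then obtain i where b: "b = axis i 1" unfolding Basis_vec_def by auto
  have "(\<lambda>x. f x \<bullet> b) = (\<lambda>x. f x $ i)" "(\<lambda>x. f' x \<bullet> b) = (\<lambda>x. f' x $ i)"
    unfolding b by (simp_all only: inner_axis inner_real_def mult_1_right)
  thus "((\<lambda>x. f x \<bullet> b) has_derivative (\<lambda>x. f' x \<bullet> b)) (at a)" using assms by simp
qed

lemma vf_vec:
  fixes \<delta> J x :: real
  defines "e \<equiv> exp (J * (1 - 2 * x))"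
  shows "vf \<delta> J (vec x) = vec ((1 - x) * e - x / e)"
proof -
  have exponent: "2 * (- \<delta> * J * x - (1 - \<delta>) * J * x + J / 2) = J * (1 - 2 * x)"
       "- 2 * (- \<delta> * J * x - (1 - \<delta>) * J * x + J / 2) = - (J * (1 - 2 * x))"
    by (simp_all add: algebra_simps)
  show ?thesis
    unfolding vf_def vec_component Let_def exponent exp_minus by (simp add: vec_eq_iff e_def field_simps)
qed

lemma has_derivative_vf_vec:
  fixes \<delta> J x :: real
  defines "e \<equiv> exp (J * (1 - 2 * x))"
  shows "(vf \<delta> J has_derivative
           (*v) (circulant (- (e + 1 / e)) (- 2 * \<delta> * J * ((1 - x) * e + x / e))
                           (- 2 * (1 - \<delta>) * J * ((1 - x) * e + x / e)))) (at (vec x))"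
proof (rule has_derivative_vec_componentwise)
  \<comment> \<open>the exponents at vec x, in the form the simplifier leaves them after differentiation\<close>
  have exp_at_vec: "exp (- (2 * (\<delta> * J * x)) - 2 * ((1 - \<delta>) * J * x) + J) = e"
       "exp (2 * ((1 - \<delta>) * J * x) + 2 * (\<delta> * J * x) - J) = 1 / e"
    by (simp_all add: e_def exp_diff algebra_simps)
  fix i
  show "((\<lambda>y. vf \<delta> J y $ i) has_derivative
         (\<lambda>h. (circulant (- (e + 1 / e)) (- 2 * \<delta> * J * ((1 - x) * e + x / e))
                   (- 2 * (1 - \<delta>) * J * ((1 - x) * e + x / e)) *v h) $ i)) (at (vec x))"
    unfolding vf_def vec_lambda_beta Let_def
    apply (rule has_derivative_eq_rhs)
     apply (rule derivative_eq_intros bounded_linear.has_derivative[OF bounded_linear_vec_nth] | simp)+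
    apply (rule ext)
    apply (cases i)
      apply (simp_all add: matrix_vector_mult_def UNIV_abc circulant_def exp_at_vec)
      apply (simp_all add: algebra_simps add_divide_distrib diff_divide_distrib)
    done
qed

lemma jac_vf_vec:
  fixes \<delta> J x :: real
  defines "e \<equiv> exp (J * (1 - 2 * x))"
  shows "jac (vf \<delta> J) (vec x) =
    circulant (- (e + 1 / e)) (- 2 * \<delta> * J * ((1 - x) * e + x / e))
              (- 2 * (1 - \<delta>) * J * ((1 - x) * e + x / e))"
  using frechet_derivative_at[OF has_derivative_vf_vec] unfolding jac_def e_def
  by (metis matrix_of_matrix_vector_mul)

lemma differentiable_vf_vec: "vf \<delta> J differentiable (at (vec x))"
  using has_derivative_vf_vec by (rule differentiableI)

lemma ctr_eq_vec: "ctr = vec (1 / 2)"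
  by (simp add: ctr_def vec_def)

lemma vf_ctr: "vf \<delta> J ctr = 0"
  by (simp add: ctr_eq_vec vf_vec vec_0[symmetric] del: vec_0)

lemma jac_vf_ctr: "jac (vf \<delta> J) ctr = circulant (- 2) (- 2 * \<delta> * J) (- 2 * (1 - \<delta>) * J)"
  by (simp add: ctr_eq_vec jac_vf_vec)

lemma charpoly_jac_vf_ctr:
  "charpoly (jac (vf \<delta> J) ctr) =
     [:- of_real (- 2 - 2 * J), 1:] * [:- Complex (J - 2) (sqrt 3 * (2 * \<delta> - 1) * J), 1:]
       * [:- Complex (J - 2) (- (sqrt 3 * (2 * \<delta> - 1) * J)), 1:]"
proof -
  have "- 2 + - 2 * (1 - \<delta>) * J + - 2 * \<delta> * J = - 2 - 2 * J"
    by (simp add: algebra_simps)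
  moreover have "circulant_eig (- 2) (- 2 * \<delta> * J) (- 2 * (1 - \<delta>) * J) =
      Complex (J - 2) (sqrt 3 * (2 * \<delta> - 1) * J)"
    by (simp add: circulant_eig_def field_simps)
  ultimately show ?thesis
    unfolding jac_vf_ctr charpoly_circulant by (simp only: complex_cnj)
qed

lemma eigs_jac_vf_ctr:
  "eigs (jac (vf \<delta> J) ctr) =
     {of_real (- 2 - 2 * J), Complex (J - 2) (sqrt 3 * (2 * \<delta> - 1) * J),
      Complex (J - 2) (- (sqrt 3 * (2 * \<delta> - 1) * J))}"
  using charpoly_jac_vf_ctr by (rule eigs_eq_linear_factors)

lemma lin_stable_vf_ctr:
  assumes "-1 < J" and "J < 0"
  shows "lin_stable (vf \<delta> J) ctr"
  unfolding lin_stable_def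
proof (intro conjI ballI)
  show "vf \<delta> J ctr = 0" by (rule vf_ctr)
  show "vf \<delta> J differentiable at ctr" unfolding ctr_eq_vec by (rule differentiable_vf_vec)
  fix z assume "z \<in> eigs (jac (vf \<delta> J) ctr)"
  then show "Re z < 0"
    using assms by (intro Re_eigs_circulant_neg[of "- 2" _ "- 2 * \<delta> * J"])
      (auto simp: jac_vf_ctr algebra_simps)
qed

lemma lin_unstable_vf_ctr:
  assumes "J < -1"
  shows "lin_unstable (vf \<delta> J) ctr"
  unfolding lin_unstable_def
proof (intro conjI bexI)
  show "vf \<delta> J ctr = 0" by (rule vf_ctr)
  show "vf \<delta> J differentiable at ctr" unfolding ctr_eq_vec by (rule differentiable_vf_vec)
  show "of_real (- 2 - 2 * J) \<in> eigs (jac (vf \<delta> J) ctr)" by (simp add: eigs_jac_vf_ctr)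
  show "0 < Re (of_real (- 2 - 2 * J))" using assms by simp
qed

lemma imaginary_eigs_jac_vf_ctr:
  fixes \<delta> :: real
  assumes "\<delta> \<noteq> 1 / 2"
  defines "\<omega> \<equiv> 2 * \<bar>sqrt 3 * (2 * \<delta> - 1)\<bar>"
  shows "order (\<i> * of_real \<omega>) (charpoly (jac (vf \<delta> 2) ctr)) = 1"
    and "order (- \<i> * of_real \<omega>) (charpoly (jac (vf \<delta> 2) ctr)) = 1"
    and "\<mu> \<in> eigs (jac (vf \<delta> 2) ctr) \<Longrightarrow> Re \<mu> = 0 \<Longrightarrow>
           \<mu> = \<i> * of_real \<omega> \<or> \<mu> = - \<i> * of_real \<omega>"
proof -
  define \<beta> where "\<beta> = sqrt 3 * (2 * \<delta> - 1)"
  have "\<beta> \<noteq> 0" using assms by (simp add: \<beta>_def)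
  have "\<omega> = 2 * \<bar>\<beta>\<bar>" by (simp add: \<omega>_def \<beta>_def)
  then have pair:
    "{\<i> * of_real \<omega>, - \<i> * of_real \<omega>} = {Complex 0 (\<beta> * 2), Complex 0 (- (\<beta> * 2))}"
    by (cases "0 \<le> \<beta>") (auto simp: complex_eq_iff)
  have "distinct [of_real (- 2 - 2 * 2), Complex (2 - 2) (\<beta> * 2), Complex (2 - 2) (- (\<beta> * 2))]"
    using \<open>\<beta> \<noteq> 0\<close> by (simp add: complex_eq_iff)
  then have "order x (charpoly (jac (vf \<delta> 2) ctr)) = 1"
    if "x \<in> {\<i> * of_real \<omega>, - \<i> * of_real \<omega>}" for x
    using that unfolding charpoly_jac_vf_ctr \<beta>_def[symmetric] pair
    by (intro order_distinct_linear_factors) auto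
  then show "order (\<i> * of_real \<omega>) (charpoly (jac (vf \<delta> 2) ctr)) = 1"
    and "order (- \<i> * of_real \<omega>) (charpoly (jac (vf \<delta> 2) ctr)) = 1"
    by simp_all
  assume "\<mu> \<in> eigs (jac (vf \<delta> 2) ctr)" and "Re \<mu> = 0"
  then have "\<mu> \<in> {Complex 0 (\<beta> * 2), Complex 0 (- (\<beta> * 2))}"
    unfolding eigs_jac_vf_ctr \<beta>_def[symmetric] by auto
  then show "\<mu> = \<i> * of_real \<omega> \<or> \<mu> = - \<i> * of_real \<omega>"
    unfolding pair[symmetric] by blast
qed

lemma hopf_bifurcation_vf_ctr:
  assumes "\<delta> \<noteq> 1 / 2"
  shows "hopf_bifurcation (vf \<delta>) ctr 2"
proof -
  define c where "c = \<bar>sqrt 3 * (2 * \<delta> - 1)\<bar>"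
  define d where "d = Complex 1 c"
  define lam where "lam J = of_real J * d - 2" for J
  have "0 < 2 * c" using assms by (simp add: c_def)
  have lam: "lam J = Complex (J - 2) (c * J)" for J
    by (simp add: lam_def d_def complex_eq_iff)
  have "\<forall>\<^sub>F J in nhds 2. vf \<delta> J ctr = 0 \<and> vf \<delta> J differentiable at ctr"
    by (intro always_eventually allI conjI vf_ctr) (simp add: ctr_eq_vec differentiable_vf_vec)
  moreover have "\<forall>\<^sub>F J in nhds 2. lam J \<in> eigs (jac (vf \<delta> J) ctr)"
    by (intro always_eventually allI, cases "0 \<le> sqrt 3 * (2 * \<delta> - 1)")
      (simp_all add: eigs_jac_vf_ctr lam c_def)
  moreover have "lam 2 = \<i> * of_real (2 * c)"
    by (simp add: lam complex_eq_iff)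
  moreover have "(lam has_vector_derivative d) (at 2)"
    unfolding lam_def
    by (rule has_vector_derivative_real_field[of "\<lambda>w. w * d - 2"]) (auto intro!: derivative_eq_intros)
  moreover have "Re d \<noteq> 0" by (simp add: d_def)
  ultimately show ?thesis
    unfolding hopf_bifurcation_def
    using \<open>0 < 2 * c\<close> imaginary_eigs_jac_vf_ctr[OF assms] unfolding c_def[symmetric]
    by blast
qed

lemma artanh_lt_div:
  fixes y :: real
  assumes "0 < y" and "y < 1"
  shows "artanh y < y / (1 - y\<^sup>2)"
proof -
  let ?f = "\<lambda>t::real. t / (1 - t\<^sup>2) - artanh t"
  have "?f 0 < ?f y"
  proof (rule DERIV_pos_imp_increasing_open[OF assms(1)])
    fix t :: real assume t: "0 < t" "t < y"
    then have "t\<^sup>2 < 1" using assms by (simp add: abs_square_less_1)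
    then have "1 - t\<^sup>2 \<noteq> 0" by simp
    have "(?f has_real_derivative (1 + t\<^sup>2) / (1 - t\<^sup>2)\<^sup>2 - 1 / (1 - t\<^sup>2)) (at t)"
      using \<open>1 - t\<^sup>2 \<noteq> 0\<close> t assms
      by (auto intro!: derivative_eq_intros simp: power2_eq_square)
    moreover have "(1 + t\<^sup>2) / (1 - t\<^sup>2)\<^sup>2 - 1 / (1 - t\<^sup>2) = 2 * t\<^sup>2 / (1 - t\<^sup>2)\<^sup>2"
      using \<open>1 - t\<^sup>2 \<noteq> 0\<close>
      by (simp add: divide_simps) (simp add: algebra_simps power2_eq_square)
    ultimately have "(?f has_real_derivative 2 * t\<^sup>2 / (1 - t\<^sup>2)\<^sup>2) (at t)"
      by simp
    moreover have "0 < 2 * t\<^sup>2 / (1 - t\<^sup>2)\<^sup>2"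
      using t \<open>1 - t\<^sup>2 \<noteq> 0\<close> by simp
    ultimately show "\<exists>D. (?f has_real_derivative D) (at t) \<and> 0 < D"
      by blast
  next
    show "continuous_on {0..y} ?f"
      using assms by (intro continuous_intros) (auto simp: abs_square_eq_1)
  qed
  then show ?thesis by simp
qed

lemma artanh_ge_cubic:
  fixes y :: real
  assumes "0 \<le> y" and "y < 1"
  shows "y + y ^ 3 / 3 \<le> artanh y"
proof -
  let ?f = "\<lambda>t::real. artanh t - t - t ^ 3 / 3"
  have "?f 0 \<le> ?f y"
  proof (rule DERIV_nonneg_imp_nondecreasing[OF assms(1)])
    fix t :: real assume t: "0 \<le> t" "t \<le> y"
    then have "t\<^sup>2 < 1" using assms by (simp add: abs_square_less_1)
    have "(?f has_real_derivative 1 / (1 - t\<^sup>2) - 1 - t\<^sup>2) (at t)"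
      using t assms by (auto intro!: derivative_eq_intros)
    moreover have "1 / (1 - t\<^sup>2) - 1 - t\<^sup>2 = t ^ 4 / (1 - t\<^sup>2)"
    proof -
      have "1 - t\<^sup>2 \<noteq> 0" using \<open>t\<^sup>2 < 1\<close> by simp
      then show ?thesis by (simp add: field_simps)
    qed
    ultimately show "\<exists>D. (?f has_real_derivative D) (at t) \<and> 0 \<le> D"
      using \<open>t\<^sup>2 < 1\<close> by force
  qed
  then show ?thesis by simp
qed

lemma artanh_eq_mult_solvable:
  fixes K :: real
  assumes "1 < K"
  shows "\<exists>y. 0 < y \<and> y < 1 \<and> artanh y = K * y"
proof -
  let ?\<phi> = "\<lambda>y. artanh y - K * y"
  define y1 where "y1 = sqrt (1 - 1 / K)"
  define y2 where "y2 = tanh (K + 1)"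
  have "0 < 1 - 1 / K" "1 - 1 / K < 1" using assms by (auto simp: field_simps)
  then have y1: "0 < y1" "y1 < 1" "1 - y1\<^sup>2 = 1 / K" by (auto simp: y1_def)
  have "?\<phi> y1 < 0" using artanh_lt_div[OF y1(1,2)] y1(3) assms by (simp add: field_simps)
  have y2: "0 < y2" "y2 < 1" using assms by (auto simp: y2_def tanh_real_lt_1)
  have "K * y2 < K" using y2 assms by simp
  then have "?\<phi> y2 > 0" by (simp add: y2_def artanh_tanh_real)
  have "connected (?\<phi> ` {0<..<1})"
    by (intro connected_continuous_image continuous_intros) auto
  then have "{?\<phi> y1..?\<phi> y2} \<subseteq> ?\<phi> ` {0<..<1}"
    by (rule connected_contains_Icc) (use y1 y2 in auto)
  then have "0 \<in> ?\<phi> ` {0<..<1}"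
    using \<open>?\<phi> y1 < 0\<close> \<open>?\<phi> y2 > 0\<close> by auto
  then show ?thesis by force
qed

definition pitchfork_root :: "real \<Rightarrow> real" where
  "pitchfork_root K = (SOME y. 0 < y \<and> y < 1 \<and> artanh y = K * y)"

lemma pitchfork_root:
  assumes "1 < K"
  shows "0 < pitchfork_root K" "pitchfork_root K < 1" "artanh (pitchfork_root K) = K * pitchfork_root K"
  using someI_ex[OF artanh_eq_mult_solvable[OF assms]] unfolding pitchfork_root_def by auto

lemma artanh_eq_mult_imp_less:
  fixes y K :: real
  assumes "0 < y" "y < 1" "artanh y = K * y"
  shows "K * (1 - y\<^sup>2) < 1"
proof -
  have "1 - y\<^sup>2 > 0" using assms by (simp add: abs_square_less_1)
  then have "K * (1 - y\<^sup>2) * y < 1 * y"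
    using artanh_lt_div[OF assms(1,2)] assms(3) by (simp add: field_simps)
  then show ?thesis using assms(1) by (simp only: mult_less_cancel_right_pos)
qed

lemma artanh_eq_mult_imp_square_le:
  fixes y K :: real
  assumes "0 < y" "y < 1" "artanh y = K * y"
  shows "y\<^sup>2 \<le> 3 * (K - 1)"
proof -
  have "y * y\<^sup>2 \<le> y * (3 * (K - 1))"
    using artanh_ge_cubic[of y] assms by (simp add: algebra_simps power2_eq_square power3_eq_cube)
  then show ?thesis using assms(1) by simp
qed

lemma pitchfork_root_tendsto: "((\<lambda>J. pitchfork_root (- J)) \<longlongrightarrow> 0) (at_left (- 1))"
proof (rule tendsto_sandwich)
  have bounds: "0 < pitchfork_root (- J) \<and> pitchfork_root (- J) \<le> sqrt (3 * (- J - 1))"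
    if "J < - 1" for J :: real
  proof -
    have "1 < - J" using that by simp
    note root = pitchfork_root[OF this]
    show ?thesis using root(1) artanh_eq_mult_imp_square_le[OF root] by (simp add: real_le_rsqrt)
  qed
  have left: "\<forall>\<^sub>F J in at_left (- 1). J < - 1" by (simp add: eventually_at_filter)
  show "\<forall>\<^sub>F J in at_left (- 1). 0 \<le> pitchfork_root (- J)"
    using left by (rule eventually_mono) (simp add: bounds less_imp_le)
  show "\<forall>\<^sub>F J in at_left (- 1). pitchfork_root (- J) \<le> sqrt (3 * (- J - 1))"
    using left by (rule eventually_mono) (use bounds in blast)
  show "((\<lambda>J. sqrt (3 * (- J - 1))) \<longlongrightarrow> 0) (at_left (- 1))"
    by (auto intro!: tendsto_eq_intros)
qed auto

lemma exp_artanh_square: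
  fixes y :: real
  assumes "-1 < y" and "y < 1"
  shows "(1 - y) * (exp (artanh y))\<^sup>2 = 1 + y"
proof -
  have "(exp (artanh y))\<^sup>2 = (1 + y) / (1 - y)"
    using assms by (simp add: artanh_def exp_double[symmetric])
  then show ?thesis using assms(2) by (simp add: field_simps)
qed

lemma lin_stable_vf_pitchfork:
  fixes \<delta> K y :: real
  assumes "0 < K" "-1 < y" "y < 1" "artanh y = K * y" "K * (1 - y\<^sup>2) < 1"
  shows "lin_stable (vf \<delta> (- K)) (vec ((1 + y) / 2))"
proof -
  define E where "E = exp (artanh y)"
  have "0 < E" "0 < 1 - y" using assms by (simp_all add: E_def)
  have E_sq: "(1 - y) * E\<^sup>2 = 1 + y"
    unfolding E_def using assms(2,3) by (rule exp_artanh_square)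
  have exp_eq: "exp (- K * (1 - 2 * ((1 + y) / 2))) = E"
    by (simp add: E_def assms(4) field_simps)
  have equilibrium: "(1 - (1 + y) / 2) * E - (1 + y) / 2 / E = 0"
    and slope: "(1 - (1 + y) / 2) * E + (1 + y) / 2 / E = (1 - y) * E"
    using E_sq \<open>0 < E\<close> by (simp_all add: field_simps power2_eq_square)
  have "(1 - y) * E * (- (E + 1 / E) + 2 * K * (1 - y) * E) =
        2 * K * (1 - y) * ((1 - y) * E\<^sup>2) - (1 - y) * E\<^sup>2 - (1 - y)"
    using \<open>0 < E\<close> by (simp add: field_simps power2_eq_square)
  also have "\<dots> = 2 * (K * (1 - y\<^sup>2) - 1)"
    unfolding E_sq by (simp add: algebra_simps power2_eq_square)
  finally have "(1 - y) * E * (- (E + 1 / E) + 2 * K * (1 - y) * E) < 0"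
    using assms(5) by simp
  then have radial: "- (E + 1 / E) + 2 * K * (1 - y) * E < 0"
    using \<open>0 < E\<close> \<open>0 < 1 - y\<close> by (simp only: mult_less_0_iff) auto
  have "0 < K * (1 - y) * E" "0 < E + 1 / E"
    using assms \<open>0 < E\<close> by (simp_all add: add_pos_pos)
  then have tangential: "- (E + 1 / E) - K * (1 - y) * E < 0"
    by linarith
  have jac: "jac (vf \<delta> (- K)) (vec ((1 + y) / 2)) =
      circulant (- (E + 1 / E)) (2 * \<delta> * K * ((1 - y) * E)) (2 * (1 - \<delta>) * K * ((1 - y) * E))"
    using jac_vf_vec[of \<delta> "- K" "(1 + y) / 2"] unfolding exp_eq slope by (simp add: algebra_simps)
  show ?thesis
    unfolding lin_stable_def
  proof (intro conjI ballI differentiable_vf_vec)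
    show "vf \<delta> (- K) (vec ((1 + y) / 2)) = 0"
      using vf_vec[of \<delta> "- K" "(1 + y) / 2"] unfolding exp_eq equilibrium by simp
    fix z assume "z \<in> eigs (jac (vf \<delta> (- K)) (vec ((1 + y) / 2)))"
    then show "Re z < 0"
      unfolding jac
      by (rule Re_eigs_circulant_neg[rotated 2])
        (use radial tangential in \<open>simp_all add: algebra_simps diff_divide_distrib\<close>)
  qed
qed

lemma pitchfork_branches:
  "\<exists>p1 p2 :: real \<Rightarrow> real^abc.
     (\<forall>J. J < -1 \<longrightarrow> p1 J \<noteq> p2 J \<and> p1 J \<noteq> ctr \<and> p2 J \<noteq> ctr
          \<and> lin_stable (vf \<delta> J) (p1 J) \<and> lin_stable (vf \<delta> J) (p2 J))
     \<and> (p1 \<longlongrightarrow> ctr) (at_left (-1)) \<and> (p2 \<longlongrightarrow> ctr) (at_left (-1))"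
proof (intro exI conjI allI impI)
  let ?p1 = "\<lambda>J. vec ((1 + pitchfork_root (- J)) / 2) :: real^abc"
  let ?p2 = "\<lambda>J. vec ((1 + - pitchfork_root (- J)) / 2) :: real^abc"
  fix J :: real assume "J < -1"
  then have "1 < - J" by simp
  note root = pitchfork_root[OF this]
  have stable: "- J * (1 - (pitchfork_root (- J))\<^sup>2) < 1"
    using artanh_eq_mult_imp_less[OF root] .
  show "?p1 J \<noteq> ?p2 J" "?p1 J \<noteq> ctr" "?p2 J \<noteq> ctr"
    using root(1) by (simp_all add: ctr_eq_vec)
  show "lin_stable (vf \<delta> J) (?p1 J)"
    using lin_stable_vf_pitchfork[of "- J" "pitchfork_root (- J)" \<delta>] root stable \<open>J < -1\<close> by simp
  show "lin_stable (vf \<delta> J) (?p2 J)"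
    using lin_stable_vf_pitchfork[of "- J" "- pitchfork_root (- J)" \<delta>] root stable \<open>J < -1\<close> by simp
next
  have "((\<lambda>J. (1 + pitchfork_root (- J)) / 2) \<longlongrightarrow> 1 / 2) (at_left (-1))"
    and "((\<lambda>J. (1 + - pitchfork_root (- J)) / 2) \<longlongrightarrow> 1 / 2) (at_left (-1))"
    using pitchfork_root_tendsto by (auto intro!: tendsto_eq_intros)
  then show "((\<lambda>J. vec ((1 + pitchfork_root (- J)) / 2) :: real^abc) \<longlongrightarrow> ctr) (at_left (-1))"
    and "((\<lambda>J. vec ((1 + - pitchfork_root (- J)) / 2) :: real^abc) \<longlongrightarrow> ctr) (at_left (-1))"
    unfolding ctr_def vec_def by (auto intro: tendsto_vec_lambda)
qed

theorem proposition1: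
  fixes \<delta> :: real
  assumes "0 \<le> \<delta>" and "\<delta> \<le> 1" and "\<delta> \<noteq> 1/2"
  shows "(\<forall>J. vf \<delta> J ctr = 0)
    \<and> (0 \<in> eigs (jac (vf \<delta> (-1)) ctr)
       \<and> (\<forall>J. -1 < J \<and> J < 0 \<longrightarrow> lin_stable (vf \<delta> J) ctr)
       \<and> (\<forall>J. J < -1 \<longrightarrow> lin_unstable (vf \<delta> J) ctr)
       \<and> (\<exists>p1 p2 :: real \<Rightarrow> real^abc.
            (\<forall>J. J < -1 \<longrightarrow> p1 J \<noteq> p2 J \<and> p1 J \<noteq> ctr \<and> p2 J \<noteq> ctr
                 \<and> lin_stable (vf \<delta> J) (p1 J) \<and> lin_stable (vf \<delta> J) (p2 J))
            \<and> (p1 \<longlongrightarrow> ctr) (at_left (-1)) \<and> (p2 \<longlongrightarrow> ctr) (at_left (-1))))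
    \<and> hopf_bifurcation (vf \<delta>) ctr 2"
proof (intro conjI allI impI)
  show "vf \<delta> J ctr = 0" for J by (rule vf_ctr)
  show "0 \<in> eigs (jac (vf \<delta> (-1)) ctr)" by (simp add: eigs_jac_vf_ctr)
  show "lin_stable (vf \<delta> J) ctr" if "-1 < J \<and> J < 0" for J
    using that by (simp add: lin_stable_vf_ctr)
  show "lin_unstable (vf \<delta> J) ctr" if "J < -1" for J
    using that by (rule lin_unstable_vf_ctr)
  show "\<exists>p1 p2 :: real \<Rightarrow> real^abc.
          (\<forall>J. J < -1 \<longrightarrow> p1 J \<noteq> p2 J \<and> p1 J \<noteq> ctr \<and> p2 J \<noteq> ctr
               \<and> lin_stable (vf \<delta> J) (p1 J) \<and> lin_stable (vf \<delta> J) (p2 J))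
          \<and> (p1 \<longlongrightarrow> ctr) (at_left (-1)) \<and> (p2 \<longlongrightarrow> ctr) (at_left (-1))"
    by (rule pitchfork_branches)
  show "hopf_bifurcation (vf \<delta>) ctr 2"
    using assms(3) by (rule hopf_bifurcation_vf_ctr)
qed

end
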